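(* For every $t\in(0,\infty)$, the Rips magnitudes of the geodesic cycles $C_n^{\mathrm{geo}}$ satisfy $$\liminf_{n\to\infty}|tC^{\mathrm{geo}}_n|_{\mathrm{Rips}}=e^{-\pi t}+2\pi t\qquad\text{and}\qquad\limsup_{n\to\infty}|tC^{\mathrm{geo}}_n|_{\mathrm{Rips}}=\infty.$$
   Context: $C_n^{\mathrm{geo}}$ denotes the set of $n$ equidistant points on the circle of total arclength $2\pi$ with the geodesic (arclength) metric. For a finite metric space $X$, the Rips magnitude function $|tX|_{\mathrm{Rips}}$ is the persistent magnitude function of the persistent homology of its Vietoris–Rips complex; equivalently, it is given for $t\in(0,\infty)$ by $|tX|_{\mathrm{Rips}}=\sum_{\emptyset\ne A\subseteq X}(-1)^{\#A-1}e^{-\mathrm{diam}(A)t}$. *)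

theory Defs
  imports "HOL-Analysis.Analysis"
begin

definition mdiam :: "'a metric \<Rightarrow> 'a set \<Rightarrow> real" where
  "mdiam X A = (SUP (x, y)\<in>A \<times> A. mdist X x y)"

text \<open>The Rips magnitude function of a finite metric space \<open>X\<close>: \<open>rips_magnitude X t\<close> is
  \<open>|tX|\<close>, the persistent magnitude of the persistent homology of the Vietoris--Rips complex,
  written as the signed sum over its simplices. Each nonempty subset \<open>A\<close> of \<open>X\<close> is a simplex
  of dimension \<open>card A - 1\<close>, entering the filtration at parameter \<open>mdiam X A\<close>.\<close>

definition rips_magnitude :: "'a metric \<Rightarrow> real \<Rightarrow> real" where
  "rips_magnitude X t =
     (\<Sum>A \<in> {A. A \<subseteq> mspace X \<and> A \<noteq> {}}. (-1) ^ (card A - 1) * exp (- mdiam X A * t))"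

text \<open>The circle of total arclength \<open>2 * pi\<close> is the unit circle in the complex plane; the shorter
  arc between \<open>z\<close> and \<open>w\<close> has length the absolute value of the principal argument of
  \<open>w / z\<close> (see \<open>arc_dist_least\<close> below).\<close>

definition arc_dist :: "complex \<Rightarrow> complex \<Rightarrow> real" where
  "arc_dist z w = \<bar>Arg (w / z)\<bar>"

lemma abs_Arg_cis_le: "\<bar>Arg (cis \<theta>)\<bar> \<le> \<bar>\<theta>\<bar>"
proof (cases "\<bar>\<theta>\<bar> < pi")
  case True
  then have "\<theta> \<in> {-pi<..pi}" by auto
  then show ?thesis by (simp only: Arg_cis)
next
  case False
  then show ?thesis using Arg_bounded[of "cis \<theta>"] by linarith
qed

lemma cis_Arg_div:
  assumes "z \<in> sphere 0 1" "w \<in> sphere 0 1"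
  shows "w = z * cis (Arg (w / z))"
proof -
  have nz: "z \<noteq> 0" "w \<noteq> 0" "cmod (w / z) = 1"
    using assms by (auto simp: norm_divide)
  then have "cis (Arg (w / z)) = w / z"
    by (metis cis_Arg divide_eq_0_iff sgn_div_norm scaleR_one inverse_1)
  then show ?thesis using nz by simp
qed

lemma arc_dist_least:
  assumes "z \<in> sphere 0 1" "w \<in> sphere 0 1"
  shows "\<exists>\<theta>. w = z * cis \<theta> \<and> arc_dist z w = \<bar>\<theta>\<bar>"
    and "\<And>\<theta>. w = z * cis \<theta> \<Longrightarrow> arc_dist z w \<le> \<bar>\<theta>\<bar>"
proof -
  show "\<exists>\<theta>. w = z * cis \<theta> \<and> arc_dist z w = \<bar>\<theta>\<bar>"
    using cis_Arg_div[OF assms] unfolding arc_dist_def by blast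
  have "z \<noteq> 0" using assms by auto
  then show "arc_dist z w \<le> \<bar>\<theta>\<bar>" if "w = z * cis \<theta>" for \<theta>
    using abs_Arg_cis_le[of \<theta>] that by (simp add: arc_dist_def)
qed

lemma Metric_space_arc_dist: "Metric_space (sphere 0 1) arc_dist"
proof
  fix x y z :: complex
  show "0 \<le> arc_dist x y" by (simp add: arc_dist_def)
  show "arc_dist x y = arc_dist y x"
    using Arg_inverse[of "x / y"] by (simp add: arc_dist_def inverse_divide)
  assume x: "x \<in> sphere 0 1" and y: "y \<in> sphere 0 1"
  have "x = y" if "arc_dist x y = 0"
    using cis_Arg_div[OF x y] that by (simp add: arc_dist_def)
  then show "arc_dist x y = 0 \<longleftrightarrow> x = y"
    using x by (auto simp: arc_dist_def)
  assume z: "z \<in> sphere 0 1"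
  have "z = x * cis (Arg (y / x) + Arg (z / y))"
    using cis_Arg_div[OF x y] cis_Arg_div[OF y z] by (metis cis_mult mult.assoc)
  from arc_dist_least(2)[OF x z this]
  show "arc_dist x z \<le> arc_dist x y + arc_dist y z"
    by (simp add: arc_dist_def)
qed

definition geo_cycle :: "nat \<Rightarrow> complex metric" where
  "geo_cycle n =
     submetric (metric (sphere 0 1, arc_dist)) {cis (2 * pi * real k / real n) | k. k < n}"

lemma mdist_geo_cycle: "mdist (geo_cycle n) = arc_dist"
  by (simp add: geo_cycle_def Metric_space.mdist_metric[OF Metric_space_arc_dist])

lemma mspace_geo_cycle: "mspace (geo_cycle n) = {cis (2 * pi * real k / real n) | k. k < n}"
  by (auto simp: geo_cycle_def mspace_submetric Metric_space.mspace_metric[OF Metric_space_arc_dist])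

end

(*
  Summation by parts turns the magnitude into x ^ (n div 2) + (1 - x) * (sum over r < n div 2 of
  x ^ r * E r) with x = exp (- 2 pi t / n), where E r is the Euler characteristic of the clique
  complex of the r-th power of the n-cycle. A direct involution argument shows that E r is n - 2r
  if n - 2r divides r, and 0 otherwise. All terms are nonnegative, and r = 0 contributes
  n (1 - x), which tends to 2 pi t; this bounds the magnitudes from below, with equality when n is
  a power of 2. A proper odd divisor 2q + 1 of n contributes at least exp (- pi t) (1 - x) n / (2q + 1),
  so numbers with many odd divisors make the magnitude diverge like the harmonic series.
*)
theory Submission
  imports Defs "HOL-Real_Asymp.Real_Asymp"
begin

section \<open>Alternating sums over families of sets\<close>

text \<open>Toggling \<open>x\<close> is a sign-reversing involution: each set without
  \<open>x\<close> cancels against its image under \<open>insert x\<close>.\<close>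

lemma sum_card_toggle_eq_0:
  assumes "finite C" and "\<And>A. A \<in> C \<Longrightarrow> finite A"
    and "\<And>A. A \<in> C \<Longrightarrow> insert x A \<in> C" and "\<And>A. A \<in> C \<Longrightarrow> A - {x} \<in> C"
  shows "(\<Sum>A\<in>C. (-1 :: real) ^ card A) = 0"
proof -
  let ?D = "{A \<in> C. x \<notin> A}"
  have C: "C = ?D \<union> insert x ` ?D"
  proof
    show "C \<subseteq> ?D \<union> insert x ` ?D"
    proof
      fix A assume A: "A \<in> C"
      show "A \<in> ?D \<union> insert x ` ?D"
      proof (cases "x \<in> A")
        case True
        then have "A = insert x (A - {x})" by auto
        moreover have "A - {x} \<in> ?D" using assms(4)[OF A] by simp
        ultimately show ?thesis by blast
      qed (use A in simp)
    qed
  qed (use assms(3) in auto)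
  have inj: "inj_on (insert x) ?D" by (auto intro!: inj_onI)
  have "(\<Sum>A\<in>C. (-1 :: real) ^ card A)
      = (\<Sum>A\<in>?D. (-1) ^ card A) + (\<Sum>A\<in>insert x ` ?D. (-1) ^ card A)"
    by (subst C, rule sum.union_disjoint) (use assms(1) in auto)
  also have "(\<Sum>A\<in>insert x ` ?D. (-1 :: real) ^ card A) = (\<Sum>A\<in>?D. - ((-1) ^ card A))"
    by (simp add: sum.reindex[OF inj], intro sum.cong refl) (use assms(2) in auto)
  finally show ?thesis by (simp add: sum_negf)
qed

lemma sum_card_Pow:
  assumes "finite S"
  shows "(\<Sum>A\<in>Pow S. (-1 :: real) ^ card A) = (if S = {} then 1 else 0)"
proof (cases "S = {}")
  case False
  then obtain x where "x \<in> S" by blast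
  then have "(\<Sum>A\<in>Pow S. (-1 :: real) ^ card A) = 0"
    by (intro sum_card_toggle_eq_0[where x = x]) (use assms in \<open>auto intro: finite_subset\<close>)
  with False show ?thesis by simp
qed simp

text \<open>Passes from signs by cardinality, with the empty face, to signs by simplex dimension;
  the left side is then an Euler characteristic.\<close>

lemma sum_card_minus_1:
  assumes "finite C" "{} \<in> C" "\<And>A. A \<in> C \<Longrightarrow> finite A"
  shows "(\<Sum>A\<in>C - {{}}. (-1 :: real) ^ (card A - 1)) = 1 - (\<Sum>A\<in>C. (-1) ^ card A)"
proof -
  have "(\<Sum>A\<in>C - {{}}. (-1 :: real) ^ (card A - 1)) = (\<Sum>A\<in>C - {{}}. - ((-1) ^ card A))"
  proof (intro sum.cong refl)
    fix A assume "A \<in> C - {{}}"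
    then have "card A \<noteq> 0" using assms(3) by auto
    then obtain k where "card A = Suc k" by (cases "card A") auto
    then show "(-1 :: real) ^ (card A - 1) = - ((-1) ^ card A)" by simp
  qed
  then show ?thesis using assms by (simp add: sum_negf sum.remove[of C "{}"])
qed

section \<open>Signed covers of an interval by intervals of fixed length\<close>

text \<open>A start point \<open>u\<close> stands for the interval \<open>{u + 1..u + s}\<close>.
  The bound \<open>m\<close> on start points is separate from \<open>a\<close> because the cliques
  below lead to \<open>a = r\<close> and \<open>m = r - j\<close>.\<close>

definition covers :: "nat \<Rightarrow> nat \<Rightarrow> nat \<Rightarrow> nat set set" where
  "covers s a m = {U. U \<subseteq> {..<m} \<and> {1..a} \<subseteq> (\<Union>u\<in>U. {u + 1..u + s})}"

definition signed_covers :: "nat \<Rightarrow> nat \<Rightarrow> nat \<Rightarrow> real" where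
  "signed_covers s a m = (\<Sum>U\<in>covers s a m. (-1) ^ card U)"

lemma finite_covers: "finite (covers s a m)"
  unfolding covers_def by (rule finite_subset[of _ "Pow {..<m}"]) auto

text \<open>Split off the rightmost interval of the cover, which starts at \<open>u\<close>.\<close>

lemma signed_covers_rec:
  assumes "1 \<le> a" "m \<le> a"
  shows "signed_covers s a m = - (\<Sum>u | u < m \<and> a \<le> u + s. signed_covers s u u)"
proof -
  let ?J = "{u. u < m \<and> a \<le> u + s}"
  have max: "A \<noteq> {}" "finite A" "Max A \<in> ?J" "A - {Max A} \<in> covers s (Max A) (Max A)"
    if A: "A \<in> covers s a m" for A
  proof -
    have sub: "A \<subseteq> {..<m}" and cov: "\<And>x. 1 \<le> x \<Longrightarrow> x \<le> a \<Longrightarrow> \<exists>u\<in>A. u + 1 \<le> x \<and> x \<le> u + s"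
      using A by (auto simp: covers_def subset_iff)
    show fin: "finite A" using sub finite_subset by blast
    obtain v where v: "v \<in> A" "a \<le> v + s" using cov[of a] assms by auto
    then show ne: "A \<noteq> {}" by auto
    have "v \<le> Max A" "Max A \<in> A" using fin ne v by auto
    then show "Max A \<in> ?J" using sub v by auto
    then have "Max A < a" using assms by auto
    \<comment> \<open>The interval of \<open>Max A\<close> starts just after \<open>Max A\<close>,
      so the smaller start points alone must cover everything up to \<open>Max A\<close>.\<close>
    show "A - {Max A} \<in> covers s (Max A) (Max A)"
      unfolding covers_def
    proof (intro CollectI conjI subsetI)
      fix x assume "x \<in> A - {Max A}"
      then show "x \<in> {..<Max A}" using fin by (simp add: order_less_le)
    next
      fix x assume x: "x \<in> {1..Max A}"
      then obtain u where "u \<in> A" "u + 1 \<le> x" "x \<le> u + s"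
        using cov[of x] \<open>Max A < a\<close> by auto
      then show "x \<in> (\<Union>u\<in>A - {Max A}. {u + 1..u + s})" using x by auto
    qed
  qed
  have Max_insert_less: "Max (insert u U) = u" if "U \<in> covers s u u" for u U
    using that by (intro Max_eqI) (auto simp: covers_def intro: finite_subset less_imp_le)
  have "(\<Sum>(u, U)\<in>Sigma ?J (\<lambda>u. covers s u u). - ((-1 :: real) ^ card U))
      = (\<Sum>A\<in>covers s a m. (-1) ^ card A)"
  proof (rule sum.reindex_bij_witness[of _ "\<lambda>A. (Max A, A - {Max A})" "\<lambda>(u, U). insert u U"])
    fix A assume A: "A \<in> covers s a m"
    then have "Max A \<in> A" using max(1,2) by simp
    then show "(case (Max A, A - {Max A}) of (u, U) \<Rightarrow> insert u U) = A" by auto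
    show "(Max A, A - {Max A}) \<in> Sigma ?J (\<lambda>u. covers s u u)" using max(3,4)[OF A] by simp
  next
    fix z assume "z \<in> Sigma ?J (\<lambda>u. covers s u u)"
    then obtain u U where z: "z = (u, U)" "u < m" "a \<le> u + s" "U \<in> covers s u u" by auto
    then have U: "U \<subseteq> {..<u}" "{1..u} \<subseteq> (\<Union>u\<in>U. {u + 1..u + s})" by (auto simp: covers_def)
    have "u \<notin> U" "finite U" using U by (auto intro: finite_subset)
    then show "(Max (case z of (u, U) \<Rightarrow> insert u U),
        (case z of (u, U) \<Rightarrow> insert u U) - {Max (case z of (u, U) \<Rightarrow> insert u U)}) = z"
      using z Max_insert_less by simp
    show "(-1 :: real) ^ card (case z of (u, U) \<Rightarrow> insert u U) = (case z of (u, U) \<Rightarrow> - ((-1) ^ card U))"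
      using z \<open>u \<notin> U\<close> \<open>finite U\<close> by simp
    have "{1..a} \<subseteq> {1..u} \<union> {u + 1..u + s}" using z by auto
    then have "{1..a} \<subseteq> (\<Union>u\<in>insert u U. {u + 1..u + s})" using U(2) by auto
    then show "(case z of (u, U) \<Rightarrow> insert u U) \<in> covers s a m"
      using z U by (auto simp: covers_def)
  qed
  also have "(\<Sum>(u, U)\<in>Sigma ?J (\<lambda>u. covers s u u). - ((-1 :: real) ^ card U))
      = (\<Sum>u\<in>?J. - signed_covers s u u)"
    by (subst sum.Sigma[symmetric]) (auto simp: finite_covers signed_covers_def sum_negf)
  finally show ?thesis by (simp add: signed_covers_def sum_negf)
qed

section \<open>Closed form of the signed covers by residues modulo \<open>s + 1\<close>\<close>

definition ind_mod_1 :: "nat \<Rightarrow> nat \<Rightarrow> real" where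
  "ind_mod_1 s m = of_bool (m mod (s + 1) = 1)"

text \<open>\<open>chain_weight s u\<close> is the coefficient of \<open>X ^ u\<close> in
  \<open>-1 / (1 + X + \<dots> + X ^ s) = (X - 1) / (1 - X ^ (s + 1))\<close>; dividing by \<open>1 - X\<close>
  produces the partial sums \<open>- ind_mod_1\<close>. For \<open>s = 0\<close> neither description applies.\<close>

definition chain_weight :: "nat \<Rightarrow> nat \<Rightarrow> real" where
  "chain_weight s u = of_bool (u mod (s + 1) = 1) - of_bool (u mod (s + 1) = 0)"

text \<open>For \<open>1 \<le> s\<close> the summand is
  \<open>ind_mod_1 s u - ind_mod_1 s (u + 1)\<close>, so the sum telescopes.\<close>

lemma sum_chain_weight:
  assumes "1 \<le> s"
  shows "(\<Sum>u<m. chain_weight s u) = - ind_mod_1 s m"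
proof (induction m)
  case (Suc m)
  have "Suc m mod (s + 1) = (if m mod (s + 1) = s then 0 else Suc (m mod (s + 1)))"
    by (simp add: mod_Suc)
  then show ?case using Suc assms by (auto simp: ind_mod_1_def chain_weight_def)
qed (simp add: ind_mod_1_def)

lemma sum_chain_weight_window:
  assumes "1 \<le> s" "a \<le> m + s"
  shows "(\<Sum>u | u < m \<and> a \<le> u + s. chain_weight s u) = ind_mod_1 s (a - s) - ind_mod_1 s m"
proof -
  have "{u. u < m \<and> a \<le> u + s} = {..<m} - {..<a - s}" by auto
  moreover have "{..<a - s} \<subseteq> {..<m}" using assms(2) by auto
  ultimately have "(\<Sum>u | u < m \<and> a \<le> u + s. chain_weight s u)
      = (\<Sum>u<m. chain_weight s u) - (\<Sum>u<a - s. chain_weight s u)"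
    by (metis sum_diff finite_lessThan)
  then show ?thesis by (simp add: sum_chain_weight[OF assms(1)])
qed

text \<open>Modulo \<open>s + 1\<close>, \<open>a - s\<close> is congruent to \<open>a + 1\<close>,
  which has residue 1 iff \<open>s + 1\<close> divides \<open>a\<close>. If
  \<open>a \<le> s\<close>, truncation gives index 0 and both sides vanish.\<close>

lemma ind_mod_1_diff:
  assumes "1 \<le> s" "1 \<le> a"
  shows "ind_mod_1 s (a - s) = of_bool (a mod (s + 1) = 0)"
proof (cases "a \<le> s")
  case True
  then show ?thesis using assms by (simp add: ind_mod_1_def)
next
  case False
  define b where "b = a - s"
  have a: "a = b + s" "1 \<le> b" using False by (auto simp: b_def)
  then obtain c where c: "b = Suc c" by (cases b) auto
  have "(c + (s + 1)) mod (s + 1) = c mod (s + 1)" by (rule mod_add_self2)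
  then have "a mod (s + 1) = c mod (s + 1)" using a c by simp
  moreover have "b mod (s + 1) = (if c mod (s + 1) = s then 0 else Suc (c mod (s + 1)))"
    using c by (simp add: mod_Suc)
  ultimately show ?thesis using assms unfolding ind_mod_1_def b_def[symmetric] by auto
qed

text \<open>In the recursion for \<open>signed_covers\<close> the induction hypothesis replaces the
  summands by chain weights, whose sum over the window telescopes.\<close>

lemma signed_covers_diag:
  assumes "1 \<le> s"
  shows "signed_covers s u u = - chain_weight s u"
proof (induction u rule: less_induct)
  case (less u)
  show ?case
  proof (cases "u = 0")
    case True
    have "covers s 0 0 = {{}}" by (auto simp: covers_def)
    with True show ?thesis by (simp add: signed_covers_def chain_weight_def)
  next
    case False
    then have "signed_covers s u u = (\<Sum>v | v < u \<and> u \<le> v + s. chain_weight s v)"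
      using less by (simp add: signed_covers_rec sum_negf)
    also have "\<dots> = of_bool (u mod (s + 1) = 0) - of_bool (u mod (s + 1) = 1)"
      using False assms by (simp add: sum_chain_weight_window ind_mod_1_diff) (simp add: ind_mod_1_def)
    finally show ?thesis by (simp add: chain_weight_def)
  qed
qed

lemma signed_covers_eq:
  assumes "1 \<le> s" "1 \<le> a" "m \<le> a" "a \<le> m + s"
  shows "signed_covers s a m = of_bool (a mod (s + 1) = 0) - ind_mod_1 s m"
  using assms
  by (simp add: signed_covers_rec signed_covers_diag sum_negf sum_chain_weight_window ind_mod_1_diff)

text \<open>Exactly one of \<open>s + 1\<close> consecutive numbers has residue 1; sliding the
  window by one trades two terms of equal residue.\<close>

lemma sum_ind_mod_1:
  assumes "1 \<le> s"
  shows "(\<Sum>i\<le>s. ind_mod_1 s (x + i)) = 1"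
proof (induction x)
  case 0
  have "(\<Sum>i\<le>s. ind_mod_1 s (0 + i)) = (\<Sum>i\<le>s. of_bool (i = 1))"
    by (intro sum.cong) (auto simp: ind_mod_1_def)
  also have "\<dots> = 1" using assms by (simp add: of_bool_def)
  finally show ?case .
next
  case (Suc x)
  have "ind_mod_1 s x + (\<Sum>i\<le>s. ind_mod_1 s (Suc x + i)) = (\<Sum>i\<le>Suc s. ind_mod_1 s (x + i))"
    by (simp add: sum.atMost_Suc_shift del: sum.atMost_Suc)
  also have "\<dots> = (\<Sum>i\<le>s. ind_mod_1 s (x + i)) + ind_mod_1 s (x + (s + 1))" by simp
  also have "ind_mod_1 s (x + (s + 1)) = ind_mod_1 s x"
    unfolding ind_mod_1_def by (simp only: mod_add_self2)
  finally show ?case using Suc by simp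
qed

text \<open>For \<open>s \<le> r\<close> the indices \<open>r - j\<close> are all but one of the
  \<open>s + 1\<close> consecutive numbers from \<open>r - s\<close> to \<open>r\<close>; the
  missing \<open>r - s\<close> has residue 1 iff \<open>s + 1\<close> divides \<open>r\<close>, if
  \<open>s\<close> is positive.\<close>

lemma sum_signed_covers:
  assumes "1 \<le> r"
  shows "(\<Sum>j<s. signed_covers s r (r - j)) = (if (s + 1) dvd r then real s else - 1)"
proof (cases "s = 0")
  case False
  let ?b = "of_bool (r mod (s + 1) = 0) :: real"
  have "(\<Sum>j<s. signed_covers s r (r - j)) = (\<Sum>j<s. ?b - ind_mod_1 s (r - j))"
    using assms False by (intro sum.cong refl signed_covers_eq) auto
  also have "\<dots> = real s * ?b - (\<Sum>j<s. ind_mod_1 s (r - j))" by (simp add: sum_subtractf)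
  also have "(\<Sum>j<s. ind_mod_1 s (r - j)) = 1 - ?b"
  \<comment> \<open>For \<open>r \<le> s\<close> the differences truncate at 0, and only
    \<open>j = r - 1\<close> contributes.\<close>
  proof (cases "r \<le> s")
    case True
    have "(\<Sum>j<s. ind_mod_1 s (r - j)) = (\<Sum>j<s. of_bool (j = r - 1))"
      using True assms by (intro sum.cong) (auto simp: ind_mod_1_def)
    also have "\<dots> = 1" using True assms by (simp add: of_bool_def)
    finally show ?thesis using True assms by simp
  next
    case False2: False
    have "(\<Sum>j<s. ind_mod_1 s (r - j)) + ind_mod_1 s (r - s) = (\<Sum>j\<le>s. ind_mod_1 s (r - j))"
      by (simp add: lessThan_Suc_atMost[symmetric])
    also have "\<dots> = (\<Sum>i\<le>s. ind_mod_1 s (r - s + i))"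
      by (rule sum.reindex_bij_witness[of _ "\<lambda>i. s - i" "\<lambda>i. s - i"]) (use False2 in auto)
    also have "\<dots> = 1" using False by (intro sum_ind_mod_1) auto
    finally show ?thesis using ind_mod_1_diff[of s r] assms False by simp
  qed
  finally show ?thesis by (auto simp: dvd_eq_mod_eq_0)
qed simp

section \<open>Alternating counts of cliques in powers of a cycle\<close>

text \<open>Graph distance on the \<open>n\<close>-cycle; maximum minus minimum yields the gap in
  either order despite truncated subtraction.\<close>

definition cyc_dist :: "nat \<Rightarrow> nat \<Rightarrow> nat \<Rightarrow> nat" where
  "cyc_dist n i j = min (max i j - min i j) (n - (max i j - min i j))"

definition cyc_cliques :: "nat \<Rightarrow> nat \<Rightarrow> nat set set" where
  "cyc_cliques n r = {A. A \<subseteq> {..<n} \<and> (\<forall>i\<in>A. \<forall>j\<in>A. cyc_dist n i j \<le> r)}"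

lemma cyc_dist_commute: "cyc_dist n i j = cyc_dist n j i"
  by (simp add: cyc_dist_def max.commute min.commute)

lemma cyc_dist_le_iff: "i \<le> j \<Longrightarrow> cyc_dist n i j \<le> r \<longleftrightarrow> j - i \<le> r \<or> n \<le> r + (j - i)"
  by (auto simp: cyc_dist_def max_def min_def)

lemma cyc_cliquesI:
  assumes "A \<subseteq> {..<n}" "\<And>i j. i \<in> A \<Longrightarrow> j \<in> A \<Longrightarrow> i < j \<Longrightarrow> j - i \<le> r \<or> n \<le> r + (j - i)"
  shows "A \<in> cyc_cliques n r"
proof -
  have "cyc_dist n i j \<le> r" if "i \<in> A" "j \<in> A" for i j
  proof (cases i j rule: linorder_cases)
    case less
    then show ?thesis using assms(2) that by (simp add: cyc_dist_le_iff)
  next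
    case equal
    then show ?thesis by (simp add: cyc_dist_def)
  next
    case greater
    then show ?thesis using assms(2)[of j i] that by (simp add: cyc_dist_le_iff cyc_dist_commute[of n i])
  qed
  with assms(1) show ?thesis by (auto simp: cyc_cliques_def)
qed

lemma cyc_cliquesD:
  assumes "A \<in> cyc_cliques n r" "i \<in> A" "j \<in> A" "i < j"
  shows "j - i \<le> r \<or> n \<le> r + (j - i)"
  using assms cyc_dist_le_iff[of i j n r] by (auto simp: cyc_cliques_def)

lemma finite_cyc_cliques: "finite (cyc_cliques n r)"
  unfolding cyc_cliques_def by (rule finite_subset[of _ "Pow {..<n}"]) auto

text \<open>The cliques whose first vertex out of reach of \<open>0\<close> is \<open>r + 1 + j\<close>.\<close>

definition far_cliques :: "nat \<Rightarrow> nat \<Rightarrow> nat \<Rightarrow> nat set set" where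
  "far_cliques n r j = {A \<in> cyc_cliques n r. r + 1 + j \<in> A \<and> A \<inter> {r + 1..r + j} = {}}"

text \<open>Put \<open>p = r + 1 + j\<close>. Every other vertex of such a clique is \<open>p - r + u\<close> with
  \<open>u < r - j\<close> or \<open>p + v\<close> with \<open>1 \<le> v \<le> r\<close>, and the only remaining restriction is that no
  \<open>v\<close> lies in \<open>{u + 1..u + s}\<close>. For a given set of \<open>u\<close>'s the alternating sum over the sets of
  \<open>v\<close>'s vanishes unless these intervals cover \<open>{1..r}\<close>.\<close>

lemma sum_far_cliques:
  assumes n: "n = 2 * r + 1 + s" and j: "j < s"
  shows "(\<Sum>A\<in>far_cliques n r j. (-1) ^ card A) = - signed_covers s r (r - j)"
proof -
  let ?free = "\<lambda>U. {1..r} - (\<Union>u\<in>U. {u + 1..u + s})"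
  let ?S = "Sigma (Pow {..<r - j}) (\<lambda>U. Pow (?free U))"
  let ?lo = "\<lambda>A. {u. u < r - j \<and> j + 1 + u \<in> A}"
  let ?hi = "\<lambda>A. {v. 1 \<le> v \<and> r + 1 + j + v \<in> A}"
  let ?join = "\<lambda>U V. insert (r + 1 + j) ((+) (j + 1) ` U \<union> (+) (r + 1 + j) ` V)"
  have dec: "A = ?join (?lo A) (?hi A)" "?hi A \<subseteq> ?free (?lo A)" if A: "A \<in> far_cliques n r j" for A
  proof -
    have AD: "r + 1 + j \<in> A" "\<And>x. x \<in> A \<Longrightarrow> r + 1 \<le> x \<Longrightarrow> x \<le> r + j \<Longrightarrow> False"
      and cl: "A \<in> cyc_cliques n r" and lt: "\<And>x. x \<in> A \<Longrightarrow> x < n"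
      using A by (auto simp: far_cliques_def cyc_cliques_def)
    \<comment> \<open>Closeness to the pivot \<open>r + 1 + j\<close> cannot come from wrapping
      around: as \<open>j < s\<close>, the gap plus \<open>r\<close> stays below \<open>n\<close>.
      The same holds on the high side because \<open>x < n\<close>.\<close>
    have low: "j + 1 \<le> x \<and> x \<le> r" if "x \<in> A" "x < r + 1 + j" for x
    proof -
      have "x \<le> r" using AD(2)[OF that(1)] that(2) by (cases "x \<le> r") auto
      then show ?thesis using cyc_cliquesD[OF cl that(1) AD(1) that(2)] n j by auto
    qed
    have high: "x \<le> r + 1 + j + r" if "x \<in> A" "r + 1 + j < x" for x
      using cyc_cliquesD[OF cl AD(1) that(1,2)] lt[OF that(1)] that n j by auto
    show "A = ?join (?lo A) (?hi A)"
    proof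
      show "A \<subseteq> ?join (?lo A) (?hi A)"
      proof
        fix x assume x: "x \<in> A"
        show "x \<in> ?join (?lo A) (?hi A)"
        proof (cases x "r + 1 + j" rule: linorder_cases)
          case less
          have "x = (j + 1) + (x - (j + 1))" "x - (j + 1) \<in> ?lo A" using low[OF x less] x by auto
          then show ?thesis by blast
        next
          case greater
          then have "x = (r + 1 + j) + (x - (r + 1 + j))" "x - (r + 1 + j) \<in> ?hi A" using x by auto
          then show ?thesis by blast
        qed simp
      qed
    qed (use AD in auto)
    show "?hi A \<subseteq> ?free (?lo A)"
    proof
      fix v assume "v \<in> ?hi A"
      then have v: "1 \<le> v" "r + 1 + j + v \<in> A" by auto
      \<comment> \<open>The two vertices differ by \<open>r + v - u\<close>: they are close directly
        iff \<open>v \<le> u\<close>, and around the cycle iff \<open>u + s < v\<close>.\<close>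
      have "\<not> (u + 1 \<le> v \<and> v \<le> u + s)" if "u \<in> ?lo A" for u
        using cyc_cliquesD[OF cl, of "j + 1 + u" "r + 1 + j + v"] that v n by auto
      then show "v \<in> ?free (?lo A)" using v high[OF v(2)] by auto
    qed
  qed
  have mem: "?join U V \<in> far_cliques n r j" if U: "U \<subseteq> {..<r - j}" and V: "V \<subseteq> ?free U" for U V
  proof -
    have u: "u + j < r" if "u \<in> U" for u using U that by auto
    have v: "1 \<le> v" "v \<le> r" if "v \<in> V" for v using V that by auto
    have uv: "v \<le> u \<or> u + s < v" if "u \<in> U" "v \<in> V" for u v using V that by fastforce
    \<comment> \<open>Vertices on one side of the pivot lie within \<open>r\<close> of each other
      and of the pivot; only mixed pairs need \<open>uv\<close>.\<close>
    have "?join U V \<in> cyc_cliques n r"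
    proof (rule cyc_cliquesI)
      show "?join U V \<subseteq> {..<n}" using u v n j by fastforce
      fix x y assume x: "x \<in> ?join U V" and y: "y \<in> ?join U V" and xy: "x < y"
      consider "x = r + 1 + j" | u where "u \<in> U" "x = j + 1 + u"
        | v where "v \<in> V" "x = r + 1 + j + v" using x by auto
      then show "y - x \<le> r \<or> n \<le> r + (y - x)"
      proof cases
        case 1
        then obtain v where "v \<in> V" "y = r + 1 + j + v" using y xy u by fastforce
        then show ?thesis using 1 v by auto
      next
        case (2 w)
        consider "y = r + 1 + j" | u where "u \<in> U" "y = j + 1 + u"
          | v where "v \<in> V" "y = r + 1 + j + v" using y by auto
        then show ?thesis
        proof cases
          case (3 v)
          then show ?thesis using uv[OF 2(1) 3(1)] 2 n by auto
        qed (use 2 u in fastforce)+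
      next
        case (3 w)
        then obtain v where "v \<in> V" "y = r + 1 + j + v" using y xy u by fastforce
        then show ?thesis using 3 v(2) by fastforce
      qed
    qed
    moreover have "?join U V \<inter> {r + 1..r + j} = {}" using u v by fastforce
    ultimately show ?thesis by (simp add: far_cliques_def)
  qed
  have "(\<Sum>A\<in>far_cliques n r j. (-1 :: real) ^ card A)
      = (\<Sum>(U, V)\<in>?S. - ((-1) ^ card U * (-1) ^ card V))"
  proof (rule sum.reindex_bij_witness[of _ "\<lambda>(U, V). ?join U V" "\<lambda>A. (?lo A, ?hi A)"])
    fix A assume A: "A \<in> far_cliques n r j"
    show "(case (?lo A, ?hi A) of (U, V) \<Rightarrow> ?join U V) = A" using dec(1)[OF A] by simp
    show "(?lo A, ?hi A) \<in> ?S" using dec(2)[OF A] by auto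
    have fin: "finite (?lo A)" "finite (?hi A)"
      using finite_subset[OF dec(2)[OF A]] by auto
    have "card (?join (?lo A) (?hi A)) = Suc (card ((+) (j + 1) ` ?lo A \<union> (+) (r + 1 + j) ` ?hi A))"
      using fin by (intro card_insert_disjoint) auto
    also have "card ((+) (j + 1) ` ?lo A \<union> (+) (r + 1 + j) ` ?hi A) = card (?lo A) + card (?hi A)"
      using fin by (subst card_Un_disjoint) (simp_all only: card_image[OF inj_on_add] finite_imageI, auto)
    finally have "card A = Suc (card (?lo A) + card (?hi A))" using dec(1)[OF A] by simp
    then show "(case (?lo A, ?hi A) of (U, V) \<Rightarrow> - ((-1 :: real) ^ card U * (-1) ^ card V)) = (-1) ^ card A"
      by (simp add: power_add)
  next
    fix z assume "z \<in> ?S"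
    then obtain U V where z: "z = (U, V)" "U \<subseteq> {..<r - j}" "V \<subseteq> ?free U" by auto
    then show "(case z of (U, V) \<Rightarrow> ?join U V) \<in> far_cliques n r j" using mem by simp
    have "?lo (?join U V) = U" "?hi (?join U V) = V" using z(2,3) by fastforce+
    then show "(?lo (case z of (U, V) \<Rightarrow> ?join U V), ?hi (case z of (U, V) \<Rightarrow> ?join U V)) = z"
      using z(1) by simp
  qed
  also have "\<dots> = (\<Sum>U\<in>Pow {..<r - j}. - ((-1) ^ card U * (\<Sum>V\<in>Pow (?free U). (-1) ^ card V)))"
    by (subst sum.Sigma[symmetric]) (auto simp: sum_distrib_left sum_negf)
  also have "\<dots> = (\<Sum>U\<in>Pow {..<r - j}. if {1..r} \<subseteq> (\<Union>u\<in>U. {u + 1..u + s}) then - ((-1) ^ card U) else 0)"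
    by (intro sum.cong refl, subst sum_card_Pow) (simp_all only: finite_Diff finite_atLeastAtMost Diff_eq_empty_iff, simp)
  also have "\<dots> = (\<Sum>U\<in>covers s r (r - j). - ((-1) ^ card U))"
    unfolding covers_def by (subst sum.inter_filter[symmetric]) (auto intro!: sum.cong)
  finally show ?thesis by (simp add: signed_covers_def sum_negf)
qed

text \<open>Cliques are sorted by their first vertex out of reach of 0. Those without one cancel by
  toggling 0; the others reduce to signed covers.\<close>

lemma sum_cyc_cliques:
  assumes "1 \<le> r" "2 * r < n"
  shows "(\<Sum>A\<in>cyc_cliques n r. (-1 :: real) ^ card A)
    = 1 - (if (n - 2 * r) dvd r then real (n - 2 * r) else 0)"
proof -
  \<comment> \<open>The \<open>s\<close> vertices \<open>r + 1\<close>, ..., \<open>r + s\<close>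
    are exactly those at distance more than \<open>r\<close> from 0.\<close>
  define s where "s = n - 2 * r - 1"
  have n: "n = 2 * r + 1 + s" using assms by (simp add: s_def)
  let ?near = "{A \<in> cyc_cliques n r. A \<inter> {r + 1..r + s} = {}}"
  have un: "cyc_cliques n r = ?near \<union> (\<Union>j<s. far_cliques n r j)"
  proof (intro equalityI subsetI)
    fix A assume A: "A \<in> cyc_cliques n r"
    show "A \<in> ?near \<union> (\<Union>j<s. far_cliques n r j)"
    proof (cases "A \<inter> {r + 1..r + s} = {}")
      case False
      define p where "p = Min (A \<inter> {r + 1..r + s})"
      have p: "p \<in> A" "r + 1 \<le> p" "p \<le> r + s"
        using Min_in[of "A \<inter> {r + 1..r + s}"] False by (auto simp: p_def)
      have least: "p \<le> x" if "x \<in> A" "r + 1 \<le> x" "x \<le> r + s" for x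
        using that by (simp add: p_def)
      define j where "j = p - (r + 1)"
      have "p = r + 1 + j" "j < s" using p by (auto simp: j_def)
      moreover have "A \<in> far_cliques n r j"
        using A p least calculation by (fastforce simp: far_cliques_def)
      ultimately show ?thesis by auto
    qed (use A in simp)
  qed (auto simp: far_cliques_def)
  have fin: "finite (far_cliques n r j)" for j
    using finite_cyc_cliques by (simp add: far_cliques_def)
  have "far_cliques n r i \<inter> far_cliques n r j = {}" if "i < j" for i j
    using that by (auto simp: far_cliques_def disjoint_iff)
  then have disj: "far_cliques n r i \<inter> far_cliques n r j = {}" if "i \<noteq> j" for i j
    using that by (metis Int_commute linorder_neq_iff)
  have "(\<Sum>A\<in>cyc_cliques n r. (-1 :: real) ^ card A)
      = (\<Sum>A\<in>?near. (-1) ^ card A) + (\<Sum>A\<in>(\<Union>j<s. far_cliques n r j). (-1) ^ card A)"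
    by (subst un, rule sum.union_disjoint)
       (use fin finite_cyc_cliques in \<open>fastforce simp: far_cliques_def\<close>)+
  also have "(\<Sum>A\<in>?near. (-1 :: real) ^ card A) = 0"
  proof (rule sum_card_toggle_eq_0[where x = 0])
    fix A assume A: "A \<in> ?near"
    show "finite A" using A by (auto simp: cyc_cliques_def intro: finite_subset)
    show "A - {0} \<in> ?near" using A by (auto simp: cyc_cliques_def)
    have "insert 0 A \<in> cyc_cliques n r"
    proof (rule cyc_cliquesI)
      show "insert 0 A \<subseteq> {..<n}" using A n by (auto simp: cyc_cliques_def)
      fix i j assume ij: "i \<in> insert 0 A" "j \<in> insert 0 A" "i < j"
      then have "j \<in> A" by auto
      then have "j \<le> r \<or> r + s < j" using A by (auto simp: disjoint_iff)
      then show "j - i \<le> r \<or> n \<le> r + (j - i)"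
        using cyc_cliquesD[of A n r i j] A \<open>j \<in> A\<close> ij n by (cases "i = 0") auto
    qed
    then show "insert 0 A \<in> ?near" using A by auto
  qed (simp add: finite_cyc_cliques)
  also have "(\<Sum>A\<in>(\<Union>j<s. far_cliques n r j). (-1 :: real) ^ card A)
      = (\<Sum>j<s. \<Sum>A\<in>far_cliques n r j. (-1) ^ card A)"
    by (rule sum.UNION_disjoint) (use fin disj in auto)
  also have "\<dots> = - (\<Sum>j<s. signed_covers s r (r - j))"
    by (simp add: sum_far_cliques[OF n] sum_negf)
  also have "\<dots> = - (if (s + 1) dvd r then real s else - 1)"
    using sum_signed_covers[OF assms(1), of s] by simp
  finally show ?thesis using n by simp
qed


section \<open>The magnitude as an arithmetic sum\<close>

definition cyc_diam :: "nat \<Rightarrow> nat set \<Rightarrow> nat" where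
  "cyc_diam n B = Max ((\<lambda>(i, j). cyc_dist n i j) ` (B \<times> B))"

lemma cyc_diam_le_iff:
  assumes "finite B" "B \<noteq> {}"
  shows "cyc_diam n B \<le> r \<longleftrightarrow> (\<forall>i\<in>B. \<forall>j\<in>B. cyc_dist n i j \<le> r)"
  unfolding cyc_diam_def using assms by (subst Max_le_iff) auto

text \<open>One step of the cycle has arclength \<open>2 * pi / n\<close>. The principal argument is
  the angle difference itself up to a half turn, and that difference minus a full turn
  beyond.\<close>

lemma arc_dist_cis:
  assumes "i < n" "j < n"
  shows "arc_dist (cis (2 * pi * real i / real n)) (cis (2 * pi * real j / real n))
    = 2 * pi / real n * real (cyc_dist n i j)"
  using assms
proof (induction i j rule: linorder_wlog)
  case (le i j)
  define \<theta> where "\<theta> = 2 * pi * real (j - i) / real n"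
  have n: "real n > 0" using le by simp
  have "cis (2 * pi * real j / real n) / cis (2 * pi * real i / real n) = cis \<theta>"
    using le(1) by (simp add: cis_divide \<theta>_def of_nat_diff right_diff_distrib diff_divide_distrib)
  then have d: "arc_dist (cis (2 * pi * real i / real n)) (cis (2 * pi * real j / real n)) = \<bar>Arg (cis \<theta>)\<bar>"
    by (simp add: arc_dist_def)
  show ?case
  proof (cases "2 * (j - i) \<le> n")
    case True
    then have "2 * real (j - i) \<le> real n" by linarith
    then have "pi * (2 * real (j - i)) \<le> pi * real n" by (intro mult_left_mono) auto
    then have th: "0 \<le> \<theta>" "\<theta> \<le> pi" using n by (auto simp: \<theta>_def field_simps)
    then have "- pi < \<theta>" using pi_gt_zero by linarith
    then have "Arg (cis \<theta>) = \<theta>" using th by (intro Arg_cis) auto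
    moreover have "cyc_dist n i j = j - i" using True le(1) by (simp add: cyc_dist_def)
    ultimately show ?thesis using d th by (simp add: \<theta>_def)
  next
    case False
    then have "real n < 2 * real (j - i)" by linarith
    then have "pi * real n < pi * (2 * real (j - i))" by (intro mult_strict_left_mono) auto
    then have "pi < \<theta>" unfolding \<theta>_def pos_less_divide_eq[OF n] by (simp only: mult_ac)
    moreover have "real (j - i) < real n" using le by linarith
    then have "\<theta> < 2 * pi" unfolding \<theta>_def pos_divide_less_eq[OF n] by simp
    ultimately have "Arg (cis (\<theta> - 2 * pi)) = \<theta> - 2 * pi"
      by (intro Arg_cis) auto
    moreover have "cis (\<theta> - 2 * pi) = cis \<theta>" by (simp flip: cis_divide)
    moreover have "cyc_dist n i j = n - (j - i)" using False le(1) by (simp add: cyc_dist_def)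
    moreover have "2 * pi / real n * real (n - (j - i)) = 2 * pi - \<theta>"
      using n le by (simp add: \<theta>_def of_nat_diff field_simps)
    ultimately show ?thesis using d \<open>\<theta> < 2 * pi\<close> by (simp del: of_nat_diff)
  qed
next
  case (sym i j)
  then show ?case
    using Metric_space.commute[OF Metric_space_arc_dist] by (metis cyc_dist_commute)
qed

lemma cyc_dist_eq_0: "i < n \<Longrightarrow> j < n \<Longrightarrow> cyc_dist n i j = 0 \<Longrightarrow> i = j"
  by (auto simp: cyc_dist_def min_def max_def split: if_splits)

lemma cyc_dist_le_half: "cyc_dist n i j \<le> n div 2"
  by (auto simp: cyc_dist_def min_def)

text \<open>Telescoping from \<open>d\<close> to \<open>M\<close>. Writing the range as an indicator
  lets the sum over simplices be taken inside, one threshold \<open>r\<close> at a time.\<close>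

lemma power_eq_sum_diff:
  fixes x :: real
  assumes "d \<le> M"
  shows "x ^ d = x ^ M + (\<Sum>r<M. of_bool (d \<le> r) * (x ^ r - x ^ Suc r))"
  using assms
proof (induction M)
  case (Suc M)
  show ?case
  proof (cases "d = Suc M")
    case True
    then show ?thesis by (simp add: sum.neutral)
  qed (use Suc in auto)
qed simp

lemma rips_magnitude_geo_cycle_sum:
  "rips_magnitude (geo_cycle n) t
    = (\<Sum>B\<in>Pow {..<n} - {{}}. (-1) ^ (card B - 1) * exp (- (2 * pi * t / real n)) ^ cyc_diam n B)"
proof -
  let ?p = "\<lambda>k. cis (2 * pi * real k / real n)"
  \<comment> \<open>Equal points have arc distance 0, hence cyclic distance 0, hence equal
    indices.\<close>
  have inj: "inj_on ?p {..<n}"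
  proof (rule inj_onI)
    fix i j assume ij: "i \<in> {..<n}" "j \<in> {..<n}" "?p i = ?p j"
    have "arc_dist (?p i) (?p i) = 0" by (simp add: arc_dist_def)
    then have "cyc_dist n i j = 0" using arc_dist_cis[of i n j] ij by simp
    then show "i = j" using cyc_dist_eq_0 ij by auto
  qed
  have diam: "mdiam (geo_cycle n) (?p ` B) = 2 * pi / real n * real (cyc_diam n B)"
    if B: "B \<subseteq> {..<n}" "B \<noteq> {}" for B
    unfolding mdiam_def mdist_geo_cycle
  proof (rule cSup_eq_maximum)
    have fin: "finite B" using B finite_subset by blast
    have ad: "arc_dist (?p i) (?p j) = 2 * pi / real n * real (cyc_dist n i j)" if "i \<in> B" "j \<in> B" for i j
      using arc_dist_cis that B by blast
    have "cyc_diam n B \<in> (\<lambda>(i, j). cyc_dist n i j) ` (B \<times> B)"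
      unfolding cyc_diam_def using fin B by (intro Max_in) auto
    then obtain i j where ij: "i \<in> B" "j \<in> B" "cyc_diam n B = cyc_dist n i j" by auto
    show "2 * pi / real n * real (cyc_diam n B) \<in> (\<lambda>(x, y). arc_dist x y) ` (?p ` B \<times> ?p ` B)"
      using ij ad[OF ij(1,2)] by (intro image_eqI[where x = "(?p i, ?p j)"]) auto
    fix z assume "z \<in> (\<lambda>(x, y). arc_dist x y) ` (?p ` B \<times> ?p ` B)"
    then obtain i j where ij: "i \<in> B" "j \<in> B" "z = arc_dist (?p i) (?p j)" by auto
    have "cyc_dist n i j \<le> cyc_diam n B" using cyc_diam_le_iff[OF fin B(2)] ij by blast
    then show "z \<le> 2 * pi / real n * real (cyc_diam n B)"
      unfolding ij(3) ad[OF ij(1,2)] by (intro mult_left_mono) auto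
  qed
  have ms: "mspace (geo_cycle n) = ?p ` {..<n}" by (auto simp: mspace_geo_cycle)
  have sets: "{A. A \<subseteq> mspace (geo_cycle n) \<and> A \<noteq> {}} = (`) ?p ` (Pow {..<n} - {{}})"
    unfolding ms by (auto simp: subset_image_iff)
  have injI: "inj_on ((`) ?p) (Pow {..<n} - {{}})"
    using inj_on_image_Pow[OF inj] by (rule inj_on_subset) auto
  have "exp (- mdiam (geo_cycle n) (?p ` B) * t) = exp (- (2 * pi * t / real n)) ^ cyc_diam n B"
    if "B \<in> Pow {..<n} - {{}}" for B
    using that by (simp add: diam flip: exp_of_nat_mult)
  moreover have "card (?p ` B) = card B" if "B \<in> Pow {..<n} - {{}}" for B
    using that inj by (intro card_image) (auto intro: inj_on_subset)
  ultimately show ?thesis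
    unfolding rips_magnitude_def sets by (subst sum.reindex[OF injI]) simp
qed

text \<open>The Euler characteristic of the Rips complex at parameter \<open>2 * pi * r / n\<close>, provided that
  \<open>2 * r < n\<close>. It is nonzero precisely for \<open>r / n = l / (2 * l + 1)\<close> with
  \<open>(2 * l + 1) dvd n\<close>, and then equals \<open>n / (2 * l + 1)\<close>.\<close>

definition euler_cycle :: "nat \<Rightarrow> nat \<Rightarrow> real" where
  "euler_cycle n r = (if (n - 2 * r) dvd r then real (n - 2 * r) else 0)"

lemma sum_cyc_diam_le:
  assumes "2 * r < n"
  shows "(\<Sum>B\<in>Pow {..<n} - {{}}. (-1) ^ (card B - 1) * of_bool (cyc_diam n B \<le> r)) = euler_cycle n r"
proof -
  have fin: "finite B" if "B \<in> Pow {..<n}" for B using that finite_subset by auto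
  have ne: "{} \<in> cyc_cliques n r" by (simp add: cyc_cliques_def)
  have "cyc_diam n B \<le> r \<longleftrightarrow> B \<in> cyc_cliques n r" if "B \<in> Pow {..<n} - {{}}" for B
    using that fin by (subst cyc_diam_le_iff) (auto simp: cyc_cliques_def)
  moreover have "cyc_cliques n r \<subseteq> Pow {..<n}" by (auto simp: cyc_cliques_def)
  ultimately have "{B \<in> Pow {..<n} - {{}}. cyc_diam n B \<le> r} = cyc_cliques n r - {{}}" by blast
  then have "(\<Sum>B\<in>Pow {..<n} - {{}}. (-1) ^ (card B - 1) * of_bool (cyc_diam n B \<le> r))
      = (\<Sum>B\<in>cyc_cliques n r - {{}}. (-1 :: real) ^ (card B - 1))"
    by (simp add: sum.inter_filter[symmetric] of_bool_def if_distrib cong: if_cong)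
  also have "\<dots> = euler_cycle n r"
  \<comment> \<open>\<open>sum_cyc_cliques\<close> assumes \<open>1 \<le> r\<close>. For
    \<open>r = 0\<close> the nonempty cliques are the \<open>n\<close> singletons, and
    \<open>euler_cycle n 0\<close> is \<open>n\<close> since every number divides 0.\<close>
  proof (cases "r = 0")
    case True
    have "cyc_cliques n r - {{}} = (\<lambda>i. {i}) ` {..<n}"
    proof
      show "cyc_cliques n r - {{}} \<subseteq> (\<lambda>i. {i}) ` {..<n}"
      proof
        fix A assume A: "A \<in> cyc_cliques n r - {{}}"
        then obtain i where i: "i \<in> A" "i < n" by (auto simp: cyc_cliques_def)
        have "j = i" if "j \<in> A" for j
          using A that i True cyc_dist_eq_0[of j n i] by (auto simp: cyc_cliques_def)
        then have "A = {i}" using i by blast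
        then show "A \<in> (\<lambda>i. {i}) ` {..<n}" using i by auto
      qed
    qed (auto simp: cyc_cliques_def cyc_dist_def)
    then show ?thesis using True by (simp add: sum.reindex euler_cycle_def)
  next
    case False
    have "(\<Sum>B\<in>cyc_cliques n r - {{}}. (-1 :: real) ^ (card B - 1))
        = 1 - (\<Sum>B\<in>cyc_cliques n r. (-1) ^ card B)"
      by (rule sum_card_minus_1) (use ne fin finite_cyc_cliques in \<open>auto simp: cyc_cliques_def\<close>)
    also have "\<dots> = euler_cycle n r"
      using False assms by (simp add: sum_cyc_cliques euler_cycle_def)
    finally show ?thesis .
  qed
  finally show ?thesis .
qed

text \<open>Abel summation: diameters are at most \<open>n div 2\<close>, and every threshold
  \<open>r < n div 2\<close> satisfies \<open>2 * r < n\<close>, where the Euler characteristic is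
  known.\<close>

lemma rips_magnitude_geo_cycle:
  fixes t :: real
  assumes "n > 0"
  defines "x \<equiv> exp (- (2 * pi * t / real n))"
  shows "rips_magnitude (geo_cycle n) t
    = x ^ (n div 2) + (1 - x) * (\<Sum>r<n div 2. x ^ r * euler_cycle n r)"
proof -
  let ?P = "Pow {..<n} - {{}}" and ?M = "n div 2"
  let ?sg = "\<lambda>B :: nat set. (-1 :: real) ^ (card B - 1)"
  have half: "cyc_diam n B \<le> ?M" if "B \<in> ?P" for B
    using that by (subst cyc_diam_le_iff) (auto simp: cyc_dist_le_half intro: finite_subset)
  \<comment> \<open>The full simplex has Euler characteristic 1, which becomes the coefficient of
    \<open>x ^ ?M\<close>.\<close>
  have one: "(\<Sum>B\<in>?P. ?sg B) = 1"
  proof -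
    have "(\<Sum>B\<in>?P. ?sg B) = 1 - (\<Sum>B\<in>Pow {..<n}. (-1) ^ card B)"
      by (rule sum_card_minus_1) (auto intro: finite_subset)
    then show ?thesis using assms by (simp add: sum_card_Pow lessThan_empty_iff)
  qed
  have "rips_magnitude (geo_cycle n) t = (\<Sum>B\<in>?P. ?sg B * x ^ cyc_diam n B)"
    by (simp add: rips_magnitude_geo_cycle_sum x_def)
  also have "\<dots> = (\<Sum>B\<in>?P. ?sg B * x ^ ?M
      + (\<Sum>r<?M. (x ^ r - x ^ Suc r) * (?sg B * of_bool (cyc_diam n B \<le> r))))"
    by (intro sum.cong refl, subst power_eq_sum_diff[OF half])
       (auto simp: distrib_left sum_distrib_left mult_ac)
  also have "\<dots> = (\<Sum>B\<in>?P. ?sg B) * x ^ ?M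
      + (\<Sum>r<?M. (x ^ r - x ^ Suc r) * (\<Sum>B\<in>?P. ?sg B * of_bool (cyc_diam n B \<le> r)))"
    unfolding sum.distrib sum_distrib_right sum_distrib_left by (subst (2) sum.swap) (rule refl)
  also have "\<dots> = x ^ ?M + (\<Sum>r<?M. (x ^ r - x ^ Suc r) * euler_cycle n r)"
    unfolding one mult_1_left
    by (intro arg_cong2[where f = "(+)"] arg_cong2[where f = "(*)"] sum.cong refl sum_cyc_diam_le) auto
  also have "(\<Sum>r<?M. (x ^ r - x ^ Suc r) * euler_cycle n r)
      = (1 - x) * (\<Sum>r<?M. x ^ r * euler_cycle n r)"
    by (simp add: sum_distrib_left algebra_simps)
  finally show ?thesis .
qed

section \<open>Asymptotics\<close>

lemma euler_cycle_nonneg: "0 \<le> euler_cycle n r"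
  by (simp add: euler_cycle_def)

lemma exp_power_half_ge:
  assumes "t \<ge> 0" "2 * r \<le> n"
  shows "exp (- pi * t) \<le> exp (- (2 * pi * t / real n)) ^ r"
proof (cases "n = 0")
  case False
  have "2 * real r \<le> real n" using assms(2) by linarith
  then have "pi * t * (2 * real r) \<le> pi * t * real n" using assms by (intro mult_left_mono) auto
  then show ?thesis using False by (simp flip: exp_of_nat_mult) (simp add: field_simps)
qed (use assms in simp)

lemma rips_magnitude_ge:
  assumes "t > 0" "n \<ge> 2"
  shows "exp (- pi * t) + real n * (1 - exp (- (2 * pi * t / real n))) \<le> rips_magnitude (geo_cycle n) t"
proof -
  define x where "x = exp (- (2 * pi * t / real n))"
  have x: "0 \<le> x" "x \<le> 1" using assms by (auto simp: x_def)
  \<comment> \<open>Only the term \<open>r = 0\<close> is kept; \<open>n \<ge> 2\<close> puts it in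
    range.\<close>
  have "real n = (\<Sum>r\<in>{0}. x ^ r * euler_cycle n r)" by (simp add: euler_cycle_def)
  also have "\<dots> \<le> (\<Sum>r<n div 2. x ^ r * euler_cycle n r)"
    by (rule sum_mono2) (use assms x in \<open>auto simp: euler_cycle_nonneg\<close>)
  finally have "(1 - x) * real n \<le> (1 - x) * (\<Sum>r<n div 2. x ^ r * euler_cycle n r)"
    using x by (intro mult_left_mono) auto
  moreover have "exp (- pi * t) \<le> x ^ (n div 2)"
    unfolding x_def using assms by (intro exp_power_half_ge) auto
  moreover have "rips_magnitude (geo_cycle n) t
      = x ^ (n div 2) + (1 - x) * (\<Sum>r<n div 2. x ^ r * euler_cycle n r)"
    unfolding x_def using assms by (intro rips_magnitude_geo_cycle) auto
  ultimately show ?thesis unfolding x_def[symmetric] by (simp add: mult.commute)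
qed

text \<open>With \<open>d = 2 ^ k - 2 * r\<close> and \<open>r = d * q\<close>, the power is
  \<open>(2 * q + 1) * d\<close>; an odd divisor of a power of 2 is 1, so \<open>q = 0\<close> and
  \<open>r = 0\<close>.\<close>

lemma euler_cycle_power_2:
  assumes "1 \<le> r" "2 * r < 2 ^ k"
  shows "euler_cycle (2 ^ k) r = 0"
proof (rule ccontr)
  assume "euler_cycle (2 ^ k) r \<noteq> 0"
  then have "2 ^ k - 2 * r dvd r" by (auto simp: euler_cycle_def split: if_splits)
  then obtain q where q: "r = (2 ^ k - 2 * r) * q" by (auto elim: dvdE)
  define d where "d = 2 ^ k - 2 * r"
  have r: "r = d * q" using q by (simp only: d_def)
  have "2 ^ k = d + 2 * r" using assms by (simp add: d_def)
  also have "\<dots> = (2 * q + 1) * d" by (subst r) (simp add: algebra_simps)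
  finally have "2 * q + 1 dvd 2 ^ k" by (metis dvd_triv_left)
  moreover have "coprime (2 * q + 1) (2 ^ k)" by simp
  ultimately have "2 * q + 1 = 1" using coprime_common_divisor_nat dvd_refl by blast
  then show False using r assms by simp
qed

lemma rips_magnitude_power_2:
  assumes "k \<ge> 1"
  shows "rips_magnitude (geo_cycle (2 ^ k)) t
    = exp (- pi * t) + real (2 ^ k) * (1 - exp (- (2 * pi * t / real (2 ^ k))))"
proof -
  define n :: nat where "n = 2 ^ k"
  define x where "x = exp (- (2 * pi * t / real n))"
  have n: "2 * (n div 2) = n" "n > 0" using assms by (auto simp: n_def)
  have "2 * real (n div 2) = real n" using n(1) by linarith
  then have "real (n div 2) * (2 * pi * t / real n) = pi * t" using n(2) by (simp add: field_simps)
  then have half: "x ^ (n div 2) = exp (- pi * t)"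
    by (simp add: x_def flip: exp_of_nat_mult)
  have "(\<Sum>r<n div 2. x ^ r * euler_cycle n r) = (\<Sum>r\<in>{0}. x ^ r * euler_cycle n r)"
  proof (rule sum.mono_neutral_right)
    show "{0} \<subseteq> {..<n div 2}" using n by auto
    show "\<forall>r\<in>{..<n div 2} - {0}. x ^ r * euler_cycle n r = 0"
      unfolding n_def by (auto intro!: euler_cycle_power_2)
  qed simp
  also have "\<dots> = real n" by (simp add: euler_cycle_def)
  finally have "rips_magnitude (geo_cycle n) t = exp (- pi * t) + real n * (1 - x)"
    using rips_magnitude_geo_cycle[OF n(2), of t] half unfolding x_def[symmetric] by simp
  then show ?thesis by (simp only: x_def n_def)
qed

lemma tendsto_lower_bound:
  fixes t :: real
  shows "(\<lambda>n. exp (- pi * t) + real n * (1 - exp (- (2 * pi * t / real n))))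
    \<longlonglongrightarrow> exp (- pi * t) + 2 * pi * t"
  by real_asymp

section \<open>Divergence along numbers with many odd divisors\<close>

lemma sum_odd_reciprocals_at_top:
  "filterlim (\<lambda>N. \<Sum>q<N. 1 / real (2 * q + 1)) at_top sequentially"
proof (rule filterlim_at_top_mono)
  show "filterlim (\<lambda>N. (1 / 2) * (harm N :: real)) at_top sequentially"
    by (rule filterlim_tendsto_pos_mult_at_top[OF tendsto_const]) (use harm_at_top in auto)
  have "(1 / 2) * (harm N :: real) \<le> (\<Sum>q<N. 1 / real (2 * q + 1))" for N
  proof (induction N)
    case (Suc N)
    \<comment> \<open>Each odd reciprocal dominates the next even one, so half the harmonic sum is a
      lower bound.\<close>
    have "(1 / 2) * (1 / real (Suc N)) \<le> 1 / real (2 * N + 1)" by (simp add: field_simps)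
    then show ?case using Suc by (simp add: harm_Suc inverse_eq_divide distrib_left)
  qed (simp add: harm_def)
  then show "\<forall>\<^sub>F N in sequentially. (1 / 2) * (harm N :: real) \<le> (\<Sum>q<N. 1 / real (2 * q + 1))" by simp
qed

text \<open>The factorial makes every \<open>2 * q + 1\<close> with \<open>q < N\<close> a divisor,
  and the factor 2 makes each cofactor \<open>d q\<close> at least 2, which keeps the index
  \<open>q * d q\<close> below half. There the Euler characteristic is \<open>d q\<close>.\<close>

lemma rips_magnitude_ge_odd_reciprocals:
  assumes "t > 0"
  defines "n \<equiv> \<lambda>N. 2 * fact (2 * N) :: nat"
  shows "exp (- pi * t) * (2 * pi * t / (1 + 2 * pi * t)) * (\<Sum>q<N. 1 / real (2 * q + 1))
    \<le> rips_magnitude (geo_cycle (n N)) t"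
proof -
  define m where "m = n N"
  define x where "x = exp (- (2 * pi * t / real m))"
  define d where "d = (\<lambda>q. m div (2 * q + 1))"
  have m: "m \<ge> 1" unfolding m_def n_def using fact_ge_1[of "2 * N"] by simp
  have x: "0 \<le> x" "x \<le> 1" using assms by (auto simp: x_def)
  have dq: "m = (2 * q + 1) * d q" "2 \<le> d q" if "q < N" for q
  proof -
    have "2 * q + 1 dvd (fact (2 * N) :: nat)" using that by (intro dvd_fact) auto
    then obtain c where c: "fact (2 * N) = (2 * q + 1) * c" by (elim dvdE)
    then have mc: "m = (2 * q + 1) * (2 * c)" by (simp add: m_def n_def)
    have "d q = 2 * c" unfolding d_def mc by (rule nonzero_mult_div_cancel_left) simp
    moreover have "c > 0" using c fact_nonzero[of "2 * N", where 'a = nat] by (cases "c = 0") auto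
    ultimately show "m = (2 * q + 1) * d q" "2 \<le> d q" using mc by simp_all
  qed
  have rq: "m - 2 * (q * d q) = d q" "q * d q < m div 2" if "q < N" for q
  proof -
    have "m = 2 * (q * d q) + d q" using dq(1)[OF that] by (simp add: algebra_simps)
    then show "m - 2 * (q * d q) = d q" "q * d q < m div 2" using dq(2)[OF that] by linarith+
  qed
  \<comment> \<open>The index determines \<open>d q\<close> as \<open>m\<close> minus twice the
    index, and hence \<open>q\<close>.\<close>
  have inj: "inj_on (\<lambda>q. q * d q) {..<N}"
  proof (rule inj_onI)
    fix p q assume pq: "p \<in> {..<N}" "q \<in> {..<N}" "p * d p = q * d q"
    then have "d p = d q" using rq(1)[of p] rq(1)[of q] by simp
    then show "p = q" using pq dq(2)[of q] by simp
  qed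
  have "exp (- pi * t) * (real m * (\<Sum>q<N. 1 / real (2 * q + 1)))
      = (\<Sum>q<N. exp (- pi * t) * real (d q))"
    unfolding sum_distrib_left
  proof (intro sum.cong refl)
    fix q assume "q \<in> {..<N}"
    then have "real m = real (2 * q + 1) * real (d q)" using dq(1)[of q] by (metis lessThan_iff of_nat_mult)
    then show "exp (- pi * t) * (real m * (1 / real (2 * q + 1))) = exp (- pi * t) * real (d q)" by simp
  qed
  also have "\<dots> \<le> (\<Sum>q<N. x ^ (q * d q) * euler_cycle m (q * d q))"
  proof (rule sum_mono)
    fix q assume "q \<in> {..<N}"
    then have "euler_cycle m (q * d q) = real (d q)" "2 * (q * d q) \<le> m"
      using rq[of q] by (auto simp: euler_cycle_def)
    moreover have "exp (- pi * t) \<le> x ^ (q * d q)"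
      unfolding x_def using assms calculation(2) by (intro exp_power_half_ge) auto
    ultimately show "exp (- pi * t) * real (d q) \<le> x ^ (q * d q) * euler_cycle m (q * d q)"
      by (simp add: mult_right_mono)
  qed
  also have "\<dots> = (\<Sum>r\<in>(\<lambda>q. q * d q) ` {..<N}. x ^ r * euler_cycle m r)"
    by (simp add: sum.reindex[OF inj])
  also have "\<dots> \<le> (\<Sum>r<m div 2. x ^ r * euler_cycle m r)"
    using rq(2) x by (intro sum_mono2) (auto simp: euler_cycle_nonneg)
  finally have S: "exp (- pi * t) * (real m * (\<Sum>q<N. 1 / real (2 * q + 1)))
      \<le> (\<Sum>r<m div 2. x ^ r * euler_cycle m r)" .
  \<comment> \<open>A bound independent of \<open>m\<close>: \<open>1 - exp (- y)\<close> is at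
    least \<open>y / (1 + y)\<close>, where \<open>y * m = 2 * pi * t\<close> and
    \<open>y \<le> 2 * pi * t\<close>.\<close>
  have "2 * pi * t / (1 + 2 * pi * t) \<le> (1 - x) * real m"
  proof -
    define y where "y = 2 * pi * t / real m"
    have y: "0 < y" "y \<le> 2 * pi * t" "y * real m = 2 * pi * t" using assms m by (auto simp: y_def field_simps)
    have "1 + y \<le> exp y" by (rule exp_ge_add_one_self)
    then have "exp (- y) \<le> 1 / (1 + y)" using y(1) by (simp add: exp_minus field_simps)
    moreover have "x = exp (- y)" by (simp only: x_def y_def)
    ultimately have "x \<le> 1 / (1 + y)" by simp
    then have "y / (1 + y) \<le> 1 - x" using y by (simp add: field_simps)
    then have "y / (1 + y) * real m \<le> (1 - x) * real m" by (intro mult_right_mono) auto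
    moreover have "y / (1 + y) * real m = 2 * pi * t / (1 + y)" using y by (simp add: field_simps)
    moreover have "2 * pi * t / (1 + 2 * pi * t) \<le> 2 * pi * t / (1 + y)"
      using y assms by (intro divide_left_mono) auto
    ultimately show ?thesis by linarith
  qed
  then have "2 * pi * t / (1 + 2 * pi * t) * (exp (- pi * t) * (\<Sum>q<N. 1 / real (2 * q + 1)))
      \<le> (1 - x) * real m * (exp (- pi * t) * (\<Sum>q<N. 1 / real (2 * q + 1)))"
    by (intro mult_right_mono) (auto intro!: mult_nonneg_nonneg sum_nonneg)
  also have "\<dots> = (1 - x) * (exp (- pi * t) * (real m * (\<Sum>q<N. 1 / real (2 * q + 1))))"
    by (simp only: mult_ac)
  also have "\<dots> \<le> (1 - x) * (\<Sum>r<m div 2. x ^ r * euler_cycle m r)"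
    using S x by (intro mult_left_mono) auto
  also have "\<dots> \<le> rips_magnitude (geo_cycle m) t"
    using rips_magnitude_geo_cycle[of m t] m x by (simp flip: x_def)
  finally show ?thesis by (simp add: m_def mult_ac)
qed

theorem theorem9p6:
  fixes t :: real
  assumes "t > 0"
  shows "liminf (\<lambda>n. ereal (rips_magnitude (geo_cycle n) t)) = ereal (exp (- pi * t) + 2 * pi * t)
       \<and> limsup (\<lambda>n. ereal (rips_magnitude (geo_cycle n) t)) = \<infinity>"
proof
  let ?f = "\<lambda>n. ereal (rips_magnitude (geo_cycle n) t)"
  let ?g = "\<lambda>n. exp (- pi * t) + real n * (1 - exp (- (2 * pi * t / real n)))"
  let ?L = "exp (- pi * t) + 2 * pi * t"
  have g: "(\<lambda>n. ereal (?g n)) \<longlonglongrightarrow> ereal ?L"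
    using tendsto_lower_bound by (intro tendsto_ereal)
  show "liminf ?f = ereal ?L"
  proof (rule antisym)
    have "\<forall>\<^sub>F n in sequentially. ereal (?g n) \<le> ?f n"
      using eventually_ge_at_top[of 2] by eventually_elim (use rips_magnitude_ge[OF assms] in simp)
    then have "liminf (\<lambda>n. ereal (?g n)) \<le> liminf ?f" by (rule Liminf_mono)
    then show "ereal ?L \<le> liminf ?f" using lim_imp_Liminf[OF sequentially_bot g] by simp
    \<comment> \<open>Along powers of 2 the lower bound \<open>?g\<close> is an equality, so this
      subsequence caps the limit inferior.\<close>
    have mono: "strict_mono (\<lambda>k. 2 ^ k :: nat)" by (simp add: strict_mono_def)
    have "((\<lambda>n. ereal (?g n)) \<circ> (\<lambda>k. 2 ^ k)) \<longlonglongrightarrow> ereal ?L"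
      using g mono by (rule LIMSEQ_subseq_LIMSEQ)
    moreover have "\<forall>\<^sub>F k in sequentially. ((\<lambda>n. ereal (?g n)) \<circ> (\<lambda>k. 2 ^ k)) k = (?f \<circ> (\<lambda>k. 2 ^ k)) k"
      using eventually_ge_at_top[of 1] by eventually_elim (use rips_magnitude_power_2 in simp)
    ultimately have "(?f \<circ> (\<lambda>k. 2 ^ k)) \<longlonglongrightarrow> ereal ?L" by (rule Lim_transform_eventually)
    then have "liminf (?f \<circ> (\<lambda>k. 2 ^ k)) = ereal ?L" by (intro lim_imp_Liminf) auto
    then show "liminf ?f \<le> ereal ?L" using liminf_subseq_mono[OF mono, of ?f] by simp
  qed
  \<comment> \<open>The shift to \<open>Suc N\<close> keeps the argument of \<open>fact\<close>
    positive, where \<open>fact\<close> is strictly increasing.\<close>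
  let ?n = "\<lambda>N. 2 * fact (2 * Suc N) :: nat"
  have mono: "strict_mono ?n"
    by (intro strict_monoI mult_strict_left_mono fact_less_mono) auto
  let ?c = "exp (- pi * t) * (2 * pi * t / (1 + 2 * pi * t))"
  have "?c > 0" using assms by (auto intro!: mult_pos_pos divide_pos_pos add_pos_pos)
  then have "filterlim (\<lambda>N. ?c * (\<Sum>q<N. 1 / real (2 * q + 1))) at_top sequentially"
    by (rule filterlim_tendsto_pos_mult_at_top[OF tendsto_const _ sum_odd_reciprocals_at_top])
  then have "filterlim (\<lambda>N. ?c * (\<Sum>q<Suc N. 1 / real (2 * q + 1))) at_top sequentially"
    by (rule filterlim_compose[OF _ filterlim_Suc])
  then have "filterlim (\<lambda>N. rips_magnitude (geo_cycle (?n N)) t) at_top sequentially"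
  proof (rule filterlim_at_top_mono)
    show "\<forall>\<^sub>F N in sequentially. ?c * (\<Sum>q<Suc N. 1 / real (2 * q + 1)) \<le> rips_magnitude (geo_cycle (?n N)) t"
      by (intro always_eventually allI rips_magnitude_ge_odd_reciprocals[OF assms])
  qed
  then have "(?f \<circ> ?n) \<longlonglongrightarrow> \<infinity>"
    unfolding o_def tendsto_PInfty_eq_at_top .
  then have "limsup (?f \<circ> ?n) = \<infinity>" by (intro lim_imp_Limsup) auto
  then show "limsup ?f = \<infinity>" using limsup_subseq_mono[OF mono, of ?f] by simp
qed

end
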